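(* Consider the two-dimensional pressure-driven annulus design problem described in the context, with $0<r_i<r_o$, $\mu>0$, $p_o<p_i$, $k_H\ge k_L>0$ and $0\le\gamma\le 1$. For a single-interface layout with inner permeability $k_1$, outer permeability $k_2$ and interface radius $\xi$, the total rate of dissipation is $$\Phi(\xi) = \frac{2\pi (p_o-p_i)^2}{\mu}\,\Upsilon_{\mathrm{2D}}(\xi)^{-1}, \qquad \Upsilon_{\mathrm{2D}}(\xi) := \frac{1}{k_1}\ln\left(\frac{\xi}{r_i}\right) + \frac{1}{k_2}\ln\left(\frac{r_o}{\xi}\right).$$ Moreover, among all admissible single-interface layouts, the total rate of dissipation is maximized by placing the high-permeability material near the inner boundary (that is, $k_1=k_H$, $k_2=k_L$) with the material interface located at $$\widehat{\xi}_{\mathrm{2D}} = \sqrt{(1-\gamma) r_i^2 + \gamma r_o^2}.$$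
   Context: The domain is the annulus $r_i<r<r_o$ in the plane. Two porous materials with permeabilities $k_H$ (high) and $k_L$ (low) fill the annulus. A single-interface layout is a radially symmetric permeability field $$k(r)=k_1 \ \text{ for } r_i<r<\xi,\qquad k(r)=k_2\ \text{ for } \xi<r<r_o,$$ where $\xi\in[r_i,r_o]$ and either $(k_1,k_2)=(k_H,k_L)$ or $(k_1,k_2)=(k_L,k_H)$. The layout is admissible if the area occupied by the high-permeability material is at most $\gamma$ times the area of the annulus: this means $\xi^2-r_i^2\le\gamma(r_o^2-r_i^2)$ when $(k_1,k_2)=(k_H,k_L)$, and $r_o^2-\xi^2\le\gamma(r_o^2-r_i^2)$ when $(k_1,k_2)=(k_L,k_H)$. For a given layout, the radial velocity $v_r(r)$ and pressure $p(r)$ solve the Darcy equations $$\frac{\mu}{k(r)}v_r+\frac{dp}{dr}=0,\qquad \frac{1}{r}\frac{d(r v_r)}{dr}=0 \quad\text{in }(r_i,r_o)$$ (away from the interface), with boundary conditions $p(r_i)=p_i$, $p(r_o)=p_o$, and with $p$ and $v_r$ continuous at $r=\xi$. The total rate of dissipation is $$\Phi=\int_{r_i}^{r_o}\frac{\mu}{k(r)}\,v_r(r)^2\,(2\pi r)\,dr.$$ *)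

theory Defs
  imports "HOL-Analysis.Analysis"
begin

text \<open>
  The value at the interface radius itself is immaterial: the Darcy equations are imposed
  away from the interface, and the dissipation integral ignores a single point.
\<close>

definition permeability :: "real \<Rightarrow> real \<Rightarrow> real \<Rightarrow> real \<Rightarrow> real" where
  "permeability k1 k2 \<xi> r = (if r < \<xi> then k1 else k2)"

definition single_interface_layout ::
    "real \<Rightarrow> real \<Rightarrow> real \<Rightarrow> real \<Rightarrow> real \<Rightarrow> real \<Rightarrow> real \<Rightarrow> bool" where
  "single_interface_layout r_i r_o k_H k_L k1 k2 \<xi> \<longleftrightarrow>
     \<xi> \<in> {r_i..r_o} \<and> ((k1, k2) = (k_H, k_L) \<or> (k1, k2) = (k_L, k_H))"

text \<open>
  For \<open>k_H = k_L\<close> the two orderings coincide as pairs; such a layout is admissible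
  if the area bound holds for one of the two labellings of the materials.
\<close>

definition admissible_layout ::
    "real \<Rightarrow> real \<Rightarrow> real \<Rightarrow> real \<Rightarrow> real \<Rightarrow> real \<Rightarrow> real \<Rightarrow> real \<Rightarrow> bool" where
  "admissible_layout r_i r_o k_H k_L \<gamma> k1 k2 \<xi> \<longleftrightarrow>
     \<xi> \<in> {r_i..r_o} \<and>
     ((k1, k2) = (k_H, k_L) \<and> \<xi>\<^sup>2 - r_i\<^sup>2 \<le> \<gamma> * (r_o\<^sup>2 - r_i\<^sup>2) \<or>
      (k1, k2) = (k_L, k_H) \<and> r_o\<^sup>2 - \<xi>\<^sup>2 \<le> \<gamma> * (r_o\<^sup>2 - r_i\<^sup>2))"

text \<open>
  Continuity of \<open>p\<close> on the closed interval gives both the continuity at the interface and the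
  meaning of the boundary conditions. Continuity of \<open>v\<close> at \<open>\<xi>\<close> is taken within the closed
  interval, so that it is one-sided when the interface lies on the boundary.
\<close>

definition darcy_solution ::
    "real \<Rightarrow> real \<Rightarrow> real \<Rightarrow> real \<Rightarrow> real \<Rightarrow> real \<Rightarrow> real \<Rightarrow> real \<Rightarrow>
     (real \<Rightarrow> real) \<Rightarrow> (real \<Rightarrow> real) \<Rightarrow> bool" where
  "darcy_solution r_i r_o \<mu> p_i p_o k1 k2 \<xi> v p \<longleftrightarrow>
     (\<forall>r\<in>{r_i<..<r_o} - {\<xi>}.
        p differentiable at r \<and>
        \<mu> / permeability k1 k2 \<xi> r * v r + deriv p r = 0 \<and>
        (\<lambda>s. s * v s) differentiable at r \<and>
        1 / r * deriv (\<lambda>s. s * v s) r = 0) \<and>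
     p r_i = p_i \<and> p r_o = p_o \<and>
     continuous_on {r_i..r_o} p \<and>
     continuous (at \<xi> within {r_i..r_o}) v"

definition dissipation ::
    "real \<Rightarrow> real \<Rightarrow> real \<Rightarrow> real \<Rightarrow> real \<Rightarrow> real \<Rightarrow> (real \<Rightarrow> real) \<Rightarrow> real" where
  "dissipation r_i r_o \<mu> k1 k2 \<xi> v =
     integral {r_i..r_o} (\<lambda>r. \<mu> / permeability k1 k2 \<xi> r * (v r)\<^sup>2 * (2 * pi * r))"

definition Upsilon_2D :: "real \<Rightarrow> real \<Rightarrow> real \<Rightarrow> real \<Rightarrow> real \<Rightarrow> real" where
  "Upsilon_2D r_i r_o k1 k2 \<xi> = 1 / k1 * ln (\<xi> / r_i) + 1 / k2 * ln (r_o / \<xi>)"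

definition xi_hat_2D :: "real \<Rightarrow> real \<Rightarrow> real \<Rightarrow> real" where
  "xi_hat_2D r_i r_o \<gamma> = sqrt ((1 - \<gamma>) * r_i\<^sup>2 + \<gamma> * r_o\<^sup>2)"

end

theory Submission
  imports Defs
begin

text \<open>
  The incompressibility equation says that the flux \<open>C = r * v r\<close> is locally constant away from
  the interface, and continuity of \<open>v\<close> at the interface forces the same constant on both sides.
  Darcy's law then reads \<open>p' = - \<mu> C / (k r)\<close>, so that \<open>p\<close> drops from \<open>r_i\<close> to \<open>r\<close> by \<open>\<mu> C\<close> times
  the resistance of the part between these radii, the integral of \<open>1 / (k s)\<close> (lemma
  \<open>resistance_has_integral\<close>). The total resistance is \<open>\<Upsilon>\<close>, hence the boundary conditions
  determine \<open>C = (p_i - p_o) / (\<mu> \<Upsilon>)\<close>, and the dissipation, which is \<open>2 \<pi> \<mu> C\<^sup>2\<close> times the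
  same integral, equals \<open>2 \<pi> (p_o - p_i)\<^sup>2 / (\<mu> \<Upsilon>)\<close>.

  Maximal dissipation therefore means minimal \<open>\<Upsilon>\<close>. With the high permeability inside, \<open>\<Upsilon>\<close>
  is nonincreasing in the interface radius, so the area bound should be exhausted, which is what
  \<open>xi_hat_2D\<close> does. With the high permeability outside, the difference to the optimal \<open>\<Upsilon>\<close>
  is \<open>(1 / k_L - 1 / k_H) (ln (\<xi> * xi_hat_2D) - ln (r_i * r_o))\<close>, and the area bound gives
  \<open>\<xi>\<^sup>2 * xi_hat_2D\<^sup>2 \<ge> r_i\<^sup>2 * r_o\<^sup>2 + \<gamma> (1 - \<gamma>) (r_o\<^sup>2 - r_i\<^sup>2)\<^sup>2\<close>.
\<close>

section \<open>The resistance of a two-layer annulus\<close>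

lemma Upsilon_2D_eq_ln:
  assumes "0 < a" "0 < b" "0 < \<xi>"
  shows "Upsilon_2D a b k1 k2 \<xi> = (1 / k1 - 1 / k2) * ln \<xi> + 1 / k2 * ln b - 1 / k1 * ln a"
  using assms unfolding Upsilon_2D_def by (simp add: ln_div algebra_simps)

lemma Upsilon_2D_pos:
  assumes "0 < a" "a < b" "\<xi> \<in> {a..b}" "0 < k1" "0 < k2"
  shows "0 < Upsilon_2D a b k1 k2 \<xi>"
proof (cases "\<xi> = a")
  case True
  then show ?thesis using assms by (simp add: Upsilon_2D_def)
next
  case False
  then have "0 < 1 / k1 * ln (\<xi> / a)" "0 \<le> 1 / k2 * ln (b / \<xi>)"
    using assms by auto
  then show ?thesis by (simp add: Upsilon_2D_def)
qed

text \<open>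
  The expression \<open>Upsilon_2D a r k1 k2 (min r \<xi>)\<close> is the resistance of the part of the annulus
  between \<open>a\<close> and \<open>r\<close>: as long as \<open>r\<close> has not reached the interface, that part consists of the
  inner material only, so its own interface is put at \<open>r\<close>.
\<close>

lemma resistance_has_derivative:
  assumes "0 < a" "0 < \<xi>" "0 < r" "r \<noteq> \<xi>"
  shows "((\<lambda>r. Upsilon_2D a r k1 k2 (min r \<xi>)) has_real_derivative
           1 / (permeability k1 k2 \<xi> r * r)) (at r)"
proof (cases "r < \<xi>")
  case True
  have "((\<lambda>r. 1 / k1 * (ln r - ln a)) has_real_derivative 1 / (k1 * r)) (at r)"
    using assms by (cases "k1 = 0") (auto intro!: derivative_eq_intros)
  then show ?thesis
    unfolding permeability_def using True assms
    by (auto elim!: has_field_derivative_transform_within_open[where S = "{0<..<\<xi>}"]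
        simp: Upsilon_2D_eq_ln algebra_simps)
next
  case False
  have "((\<lambda>r. (1 / k1 - 1 / k2) * ln \<xi> + 1 / k2 * ln r - 1 / k1 * ln a)
          has_real_derivative 1 / (k2 * r)) (at r)"
    using assms by (cases "k2 = 0") (auto intro!: derivative_eq_intros)
  then show ?thesis
    unfolding permeability_def using False assms
    by (auto elim!: has_field_derivative_transform_within_open[where S = "{\<xi><..}"]
        simp: Upsilon_2D_eq_ln algebra_simps)
qed

lemma resistance_continuous:
  assumes "0 < a" "0 < \<xi>"
  shows "continuous_on {a..b} (\<lambda>r. Upsilon_2D a r k1 k2 (min r \<xi>))"
proof -
  have "continuous_on {a..b} (\<lambda>r. (1 / k1 - 1 / k2) * ln (min r \<xi>) + 1 / k2 * ln r - 1 / k1 * ln a)"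
    using assms by (intro continuous_intros) auto
  then show ?thesis
    by (rule continuous_on_eq) (use assms in \<open>auto simp: Upsilon_2D_eq_ln\<close>)
qed

lemma resistance_has_integral:
  assumes "0 < a" "a < b" "\<xi> \<in> {a..b}"
  shows "((\<lambda>r. 1 / (permeability k1 k2 \<xi> r * r)) has_integral Upsilon_2D a b k1 k2 \<xi>) {a..b}"
proof -
  let ?L = "\<lambda>r. Upsilon_2D a r k1 k2 (min r \<xi>)"
  have "((\<lambda>r. 1 / (permeability k1 k2 \<xi> r * r)) has_integral ?L b - ?L a) {a..b}"
  proof (rule fundamental_theorem_of_calculus_interior_strong[where S = "{\<xi>}"])
    show "(?L has_vector_derivative 1 / (permeability k1 k2 \<xi> r * r)) (at r)"
      if "r \<in> {a<..<b} - {\<xi>}" for r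
      using resistance_has_derivative[of a \<xi> r k1 k2] that assms
      by (simp add: has_real_derivative_iff_has_vector_derivative)
  qed (use assms resistance_continuous[of a \<xi>] in auto)
  then show ?thesis
    using assms by (simp add: min_absorb1 min_absorb2 Upsilon_2D_def)
qed

section \<open>Solutions of the Darcy equations\<close>

lemma darcy_solution_exists:
  assumes "0 < a" "a < b" "\<xi> \<in> {a..b}" "0 < k1" "0 < k2" "0 < \<mu>"
  shows "\<exists>v p. darcy_solution a b \<mu> p_i p_o k1 k2 \<xi> v p"
proof -
  let ?L = "\<lambda>r. Upsilon_2D a r k1 k2 (min r \<xi>)"
  define C where "C = (p_i - p_o) / (\<mu> * Upsilon_2D a b k1 k2 \<xi>)"
  define v where "v = (\<lambda>r::real. C / r)"
  define p where "p = (\<lambda>r. p_i - \<mu> * C * ?L r)"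
  have pos: "0 < Upsilon_2D a b k1 k2 \<xi>"
    using assms by (intro Upsilon_2D_pos)
  have flux: "((\<lambda>s. s * v s) has_real_derivative 0) (at r)"
    and p': "(p has_real_derivative - \<mu> * C * (1 / (permeability k1 k2 \<xi> r * r))) (at r)"
    if "r \<in> {a<..<b} - {\<xi>}" for r
  proof -
    have "((\<lambda>s. C) has_real_derivative 0) (at r)"
      by simp
    then show "((\<lambda>s. s * v s) has_real_derivative 0) (at r)"
      by (rule has_field_derivative_transform_within_open[where S = "{0<..}"])
         (use that assms in \<open>auto simp: v_def\<close>)
    show "(p has_real_derivative - \<mu> * C * (1 / (permeability k1 k2 \<xi> r * r))) (at r)"
      unfolding p_def using that assms
      by (auto intro!: derivative_eq_intros resistance_has_derivative)
  qed
  have "\<mu> / permeability k1 k2 \<xi> r * v r + deriv p r = 0" if "r \<in> {a<..<b} - {\<xi>}" for r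
    using DERIV_imp_deriv[OF p'[OF that]] by (simp add: v_def)
  moreover have "p differentiable at r" "(\<lambda>s. s * v s) differentiable at r"
    if "r \<in> {a<..<b} - {\<xi>}" for r
    using p'[OF that] flux[OF that] by (auto simp: real_differentiable_def)
  moreover have "p a = p_i"
    using assms by (simp add: p_def min_absorb1 Upsilon_2D_def)
  moreover have "p b = p_o"
    using assms pos by (simp add: p_def min_absorb2 C_def)
  moreover have "continuous_on {a..b} p"
    unfolding p_def using assms by (intro continuous_intros resistance_continuous) auto
  moreover have "continuous (at \<xi> within {a..b}) v"
    unfolding v_def using assms by (intro continuous_intros) auto
  moreover have "deriv (\<lambda>s. s * v s) r = 0" if "r \<in> {a<..<b} - {\<xi>}" for r
    using DERIV_imp_deriv[OF flux[OF that]] .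
  ultimately have "darcy_solution a b \<mu> p_i p_o k1 k2 \<xi> v p"
    unfolding darcy_solution_def by auto
  then show ?thesis by blast
qed

text \<open>
  Every radius is compared with the interface itself: \<open>s * v s\<close> is continuous on the closed
  segment between them and has zero derivative inside. This treats both sides, and an interface
  on the boundary, in the same way; the boundary values of \<open>v\<close> stay undetermined unless the
  interface lies there.
\<close>

lemma darcy_flux_constant:
  assumes sol: "darcy_solution a b \<mu> p_i p_o k1 k2 \<xi> v p"
    and a: "0 < a" and \<xi>: "\<xi> \<in> {a..b}" and r: "r \<in> {a<..<b}"
  shows "r * v r = \<xi> * v \<xi>"
proof -
  let ?f = "\<lambda>s. s * v s"
  have der: "(?f has_real_derivative 0) (at s)" if "s \<in> {a<..<b} - {\<xi>}" for s
  proof -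
    have "?f differentiable at s" "1 / s * deriv ?f s = 0"
      using sol that unfolding darcy_solution_def by blast+
    moreover have "s \<noteq> 0" using that a by auto
    ultimately show ?thesis
      by (metis DERIV_deriv_iff_real_differentiable divide_eq_0_iff mult_eq_0_iff one_neq_zero)
  qed
  have at_\<xi>: "continuous (at \<xi> within {a..b}) ?f"
    using sol unfolding darcy_solution_def by (intro continuous_intros) auto
  have cont: "continuous_on S ?f" if "S \<subseteq> insert \<xi> {a<..<b}" for S
    unfolding continuous_on_eq_continuous_within
  proof
    fix s assume s: "s \<in> S"
    show "continuous (at s within S) ?f"
    proof (cases "s = \<xi>")
      case True
      have "S \<subseteq> {a..b}" using that \<xi> by auto
      then show ?thesis using at_\<xi> True by (blast intro: continuous_within_subset)
    next
      case False
      then have "s \<in> {a<..<b} - {\<xi>}" using s that by auto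
      then have "isCont ?f s" by (intro DERIV_isCont[OF der])
      then show ?thesis by (rule continuous_at_imp_continuous_at_within)
    qed
  qed
  consider "r < \<xi>" | "r = \<xi>" | "\<xi> < r" by linarith
  then show ?thesis
  proof cases
    case 1
    then show ?thesis
      using DERIV_isconst_end[of r \<xi> ?f] der cont[of "{r..\<xi>}"] r \<xi> by force
  next
    case 3
    then show ?thesis
      using DERIV_isconst_end[of \<xi> r ?f] der cont[of "{\<xi>..r}"] r \<xi> by force
  qed simp
qed

lemma darcy_pressure_drop:
  assumes sol: "darcy_solution a b \<mu> p_i p_o k1 k2 \<xi> v p"
    and "0 < a" "a < b" "\<xi> \<in> {a..b}"
  shows "p_i - p_o = \<mu> * (\<xi> * v \<xi>) * Upsilon_2D a b k1 k2 \<xi>"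
proof -
  let ?k = "permeability k1 k2 \<xi>" and ?C = "\<xi> * v \<xi>"
  have "((\<lambda>r. - \<mu> * ?C * (1 / (?k r * r))) has_integral p b - p a) {a..b}"
  proof (rule fundamental_theorem_of_calculus_interior_strong[where S = "{\<xi>}"])
    fix r assume r: "r \<in> {a<..<b} - {\<xi>}"
    have "p differentiable at r" and darcy: "\<mu> / ?k r * v r + deriv p r = 0"
      using sol r unfolding darcy_solution_def by blast+
    then have "(p has_real_derivative deriv p r) (at r)"
      by (simp add: DERIV_deriv_iff_real_differentiable)
    moreover have "v r = ?C / r"
      using darcy_flux_constant[OF sol, of r] assms r by (simp add: field_simps)
    then have "deriv p r = - \<mu> * ?C * (1 / (?k r * r))"
      using darcy by (simp add: field_simps)
    ultimately show "(p has_vector_derivative - \<mu> * ?C * (1 / (?k r * r))) (at r)"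
      by (simp add: has_real_derivative_iff_has_vector_derivative)
  qed (use assms in \<open>auto simp: darcy_solution_def\<close>)
  moreover have "((\<lambda>r. - \<mu> * ?C * (1 / (?k r * r))) has_integral
                   - \<mu> * ?C * Upsilon_2D a b k1 k2 \<xi>) {a..b}"
    by (rule has_integral_mult_right[OF resistance_has_integral]) (use assms in auto)
  ultimately have "p b - p a = - \<mu> * ?C * Upsilon_2D a b k1 k2 \<xi>"
    by (rule has_integral_unique)
  then show ?thesis
    using sol unfolding darcy_solution_def by simp
qed

lemma dissipation_eq_flux:
  assumes sol: "darcy_solution a b \<mu> p_i p_o k1 k2 \<xi> v p"
    and "0 < a" "a < b" "\<xi> \<in> {a..b}"
  shows "dissipation a b \<mu> k1 k2 \<xi> v = 2 * pi * \<mu> * (\<xi> * v \<xi>)\<^sup>2 * Upsilon_2D a b k1 k2 \<xi>"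
proof -
  let ?k = "permeability k1 k2 \<xi>" and ?C = "\<xi> * v \<xi>"
  have "((\<lambda>r. 2 * pi * \<mu> * ?C\<^sup>2 * (1 / (?k r * r))) has_integral
          2 * pi * \<mu> * ?C\<^sup>2 * Upsilon_2D a b k1 k2 \<xi>) {a..b}"
    by (rule has_integral_mult_right[OF resistance_has_integral]) (use assms in auto)
  then have "((\<lambda>r. \<mu> / ?k r * (v r)\<^sup>2 * (2 * pi * r)) has_integral
          2 * pi * \<mu> * ?C\<^sup>2 * Upsilon_2D a b k1 k2 \<xi>) {a..b}"
  proof (rule has_integral_spike_finite[where S = "{a, b}", rotated 2])
    fix r assume "r \<in> {a..b} - {a, b}"
    then have r: "r \<in> {a<..<b}" by auto
    then have "v r = ?C / r" "r \<noteq> 0"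
      using darcy_flux_constant[OF sol, of r] assms by (auto simp: field_simps)
    then show "\<mu> / ?k r * (v r)\<^sup>2 * (2 * pi * r) = 2 * pi * \<mu> * ?C\<^sup>2 * (1 / (?k r * r))"
      by (simp add: power2_eq_square)
  qed simp
  then show ?thesis
    unfolding dissipation_def by (rule integral_unique)
qed

lemma dissipation_formula:
  assumes sol: "darcy_solution a b \<mu> p_i p_o k1 k2 \<xi> v p"
    and "0 < a" "a < b" "\<xi> \<in> {a..b}" "0 < k1" "0 < k2" "0 < \<mu>"
  shows "dissipation a b \<mu> k1 k2 \<xi> v =
           2 * pi * (p_o - p_i)\<^sup>2 / \<mu> * inverse (Upsilon_2D a b k1 k2 \<xi>)"
proof -
  have "0 < Upsilon_2D a b k1 k2 \<xi>"
    using assms by (intro Upsilon_2D_pos)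
  moreover have "(p_o - p_i)\<^sup>2 = (\<mu> * (\<xi> * v \<xi>) * Upsilon_2D a b k1 k2 \<xi>)\<^sup>2"
    using darcy_pressure_drop[OF sol] assms by (simp add: power2_commute)
  ultimately show ?thesis
    using dissipation_eq_flux[OF sol] assms by (simp add: power2_eq_square)
qed

section \<open>The optimal layout\<close>

lemma xi_hat_2D_square:
  assumes "0 \<le> \<gamma>" "\<gamma> \<le> 1"
  shows "(xi_hat_2D a b \<gamma>)\<^sup>2 = (1 - \<gamma>) * a\<^sup>2 + \<gamma> * b\<^sup>2"
  using assms by (simp add: xi_hat_2D_def)

lemma xi_hat_2D_mem:
  assumes "0 < a" "a < b" "0 \<le> \<gamma>" "\<gamma> \<le> 1"
  shows "xi_hat_2D a b \<gamma> \<in> {a..b}"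
proof -
  have "a\<^sup>2 \<le> b\<^sup>2" using assms by (simp add: power_mono)
  then have "0 \<le> \<gamma> * (b\<^sup>2 - a\<^sup>2)" "0 \<le> (1 - \<gamma>) * (b\<^sup>2 - a\<^sup>2)"
    using assms by auto
  then have "a\<^sup>2 \<le> (1 - \<gamma>) * a\<^sup>2 + \<gamma> * b\<^sup>2" "(1 - \<gamma>) * a\<^sup>2 + \<gamma> * b\<^sup>2 \<le> b\<^sup>2"
    by (simp_all add: algebra_simps)
  then show ?thesis
    using assms by (auto simp: xi_hat_2D_def intro: real_le_rsqrt real_le_lsqrt)
qed

lemma xi_hat_2D_admissible:
  assumes "0 < a" "a < b" "0 \<le> \<gamma>" "\<gamma> \<le> 1"
  shows "admissible_layout a b k_H k_L \<gamma> k_H k_L (xi_hat_2D a b \<gamma>)"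
  using assms xi_hat_2D_mem[of a b \<gamma>]
  by (auto simp: admissible_layout_def xi_hat_2D_square algebra_simps)

lemma Upsilon_2D_xi_hat_le:
  assumes "0 < a" "a < b" "0 < k_L" "k_L \<le> k_H" "0 \<le> \<gamma>" "\<gamma> \<le> 1"
    and adm: "admissible_layout a b k_H k_L \<gamma> k1 k2 \<xi>"
  shows "Upsilon_2D a b k_H k_L (xi_hat_2D a b \<gamma>) \<le> Upsilon_2D a b k1 k2 \<xi>"
proof -
  let ?\<eta> = "xi_hat_2D a b \<gamma>"
  have \<xi>: "\<xi> \<in> {a..b}" using adm by (simp add: admissible_layout_def)
  have \<eta>: "?\<eta> \<in> {a..b}" using assms by (intro xi_hat_2D_mem)
  have pos: "0 < b" "0 < \<xi>" "0 < ?\<eta>" using assms \<xi> \<eta> by auto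
  have k: "0 \<le> 1 / k_L - 1 / k_H" using assms by (simp add: frac_le)
  from adm consider
    (inside) "k1 = k_H" "k2 = k_L" "\<xi>\<^sup>2 - a\<^sup>2 \<le> \<gamma> * (b\<^sup>2 - a\<^sup>2)" |
    (outside) "k1 = k_L" "k2 = k_H" "b\<^sup>2 - \<xi>\<^sup>2 \<le> \<gamma> * (b\<^sup>2 - a\<^sup>2)"
    unfolding admissible_layout_def by blast
  then show ?thesis
  proof cases
    case inside
    then have "\<xi>\<^sup>2 \<le> ?\<eta>\<^sup>2"
      using assms by (simp add: xi_hat_2D_square algebra_simps)
    then have "\<xi> \<le> ?\<eta>" by (rule power2_le_imp_le) (use pos in auto)
    then have "0 \<le> (1 / k_L - 1 / k_H) * (ln ?\<eta> - ln \<xi>)"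
      using k pos by (intro mult_nonneg_nonneg) auto
    then show ?thesis
      using inside assms pos by (simp add: Upsilon_2D_eq_ln algebra_simps)
  next
    case outside
    \<comment> \<open>The smallest value of \<open>\<xi>\<^sup>2\<close> that the area bound permits.\<close>
    define c where "c = b\<^sup>2 - \<gamma> * (b\<^sup>2 - a\<^sup>2)"
    have "a\<^sup>2 * b\<^sup>2 \<le> a\<^sup>2 * b\<^sup>2 + \<gamma> * (1 - \<gamma>) * (b\<^sup>2 - a\<^sup>2)\<^sup>2"
      using assms by simp
    also have "\<dots> = c * ?\<eta>\<^sup>2"
      using assms unfolding c_def xi_hat_2D_square[OF assms(5,6)]
      by (simp add: power2_eq_square algebra_simps)
    also have "\<dots> \<le> \<xi>\<^sup>2 * ?\<eta>\<^sup>2"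
      using outside by (intro mult_right_mono) (auto simp: c_def)
    finally have "(a * b)\<^sup>2 \<le> (\<xi> * ?\<eta>)\<^sup>2" by (simp add: power_mult_distrib)
    then have "a * b \<le> \<xi> * ?\<eta>" by (rule power2_le_imp_le) (use pos in auto)
    then have "ln (a * b) \<le> ln (\<xi> * ?\<eta>)" using pos assms by simp
    then have "ln a + ln b \<le> ln \<xi> + ln ?\<eta>"
      using pos assms by (simp add: ln_mult)
    then have "0 \<le> (1 / k_L - 1 / k_H) * (ln \<xi> + ln ?\<eta> - ln a - ln b)"
      using k by (intro mult_nonneg_nonneg) auto
    then show ?thesis
      using outside assms pos by (simp add: Upsilon_2D_eq_ln algebra_simps)
  qed
qed

theorem mainTheorem3:
  fixes r_i r_o \<mu> p_i p_o k_H k_L \<gamma> :: real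
  assumes "0 < r_i" and "r_i < r_o" and "\<mu> > 0" and "p_o < p_i"
    and "k_H \<ge> k_L" and "k_L > 0" and "0 \<le> \<gamma>" and "\<gamma> \<le> 1"
  shows
    "(\<forall>k1 k2 \<xi>. single_interface_layout r_i r_o k_H k_L k1 k2 \<xi> \<longrightarrow>
        (\<exists>v p. darcy_solution r_i r_o \<mu> p_i p_o k1 k2 \<xi> v p) \<and>
        (\<forall>v p. darcy_solution r_i r_o \<mu> p_i p_o k1 k2 \<xi> v p \<longrightarrow>
           dissipation r_i r_o \<mu> k1 k2 \<xi> v =
             2 * pi * (p_o - p_i)\<^sup>2 / \<mu> * inverse (Upsilon_2D r_i r_o k1 k2 \<xi>))) \<and>
     admissible_layout r_i r_o k_H k_L \<gamma> k_H k_L (xi_hat_2D r_i r_o \<gamma>) \<and>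
     (\<forall>k1 k2 \<xi> v p v_hat p_hat.
        admissible_layout r_i r_o k_H k_L \<gamma> k1 k2 \<xi> \<and>
        darcy_solution r_i r_o \<mu> p_i p_o k1 k2 \<xi> v p \<and>
        darcy_solution r_i r_o \<mu> p_i p_o k_H k_L (xi_hat_2D r_i r_o \<gamma>) v_hat p_hat \<longrightarrow>
        dissipation r_i r_o \<mu> k1 k2 \<xi> v
          \<le> dissipation r_i r_o \<mu> k_H k_L (xi_hat_2D r_i r_o \<gamma>) v_hat)"
proof -
  have kH: "0 < k_H" using assms by linarith
  have formula: "dissipation r_i r_o \<mu> k1 k2 \<xi> v =
      2 * pi * (p_o - p_i)\<^sup>2 / \<mu> * inverse (Upsilon_2D r_i r_o k1 k2 \<xi>)"
    if "single_interface_layout r_i r_o k_H k_L k1 k2 \<xi>"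
      "darcy_solution r_i r_o \<mu> p_i p_o k1 k2 \<xi> v p" for k1 k2 \<xi> v p
    using that assms kH by (intro dissipation_formula) (auto simp: single_interface_layout_def)
  have ex: "\<exists>v p. darcy_solution r_i r_o \<mu> p_i p_o k1 k2 \<xi> v p"
    if "single_interface_layout r_i r_o k_H k_L k1 k2 \<xi>" for k1 k2 \<xi>
    using that assms kH by (intro darcy_solution_exists) (auto simp: single_interface_layout_def)
  have layout: "single_interface_layout r_i r_o k_H k_L k1 k2 \<xi>"
    if "admissible_layout r_i r_o k_H k_L \<gamma> k1 k2 \<xi>" for k1 k2 \<xi>
    using that by (auto simp: admissible_layout_def single_interface_layout_def)
  let ?\<eta> = "xi_hat_2D r_i r_o \<gamma>"
  have adm: "admissible_layout r_i r_o k_H k_L \<gamma> k_H k_L ?\<eta>"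
    using assms by (intro xi_hat_2D_admissible)
  have opt: "dissipation r_i r_o \<mu> k1 k2 \<xi> v \<le> dissipation r_i r_o \<mu> k_H k_L ?\<eta> v_hat"
    if "admissible_layout r_i r_o k_H k_L \<gamma> k1 k2 \<xi>"
      "darcy_solution r_i r_o \<mu> p_i p_o k1 k2 \<xi> v p"
      "darcy_solution r_i r_o \<mu> p_i p_o k_H k_L ?\<eta> v_hat p_hat"
    for k1 k2 \<xi> v p v_hat p_hat
  proof -
    have "0 < Upsilon_2D r_i r_o k_H k_L ?\<eta>"
      using assms kH by (intro Upsilon_2D_pos xi_hat_2D_mem)
    moreover have "Upsilon_2D r_i r_o k_H k_L ?\<eta> \<le> Upsilon_2D r_i r_o k1 k2 \<xi>"
      using assms that(1) by (intro Upsilon_2D_xi_hat_le)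
    ultimately have "inverse (Upsilon_2D r_i r_o k1 k2 \<xi>) \<le> inverse (Upsilon_2D r_i r_o k_H k_L ?\<eta>)"
      by (intro le_imp_inverse_le)
    then show ?thesis
      unfolding formula[OF layout[OF that(1)] that(2)] formula[OF layout[OF adm] that(3)]
      using assms by (intro mult_left_mono) auto
  qed
  show ?thesis
    using formula ex adm opt by blast
qed

end
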